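(* Let $x^*$ be an optimal solution of the problem $\min\{f(x): x\in\mathcal X,\ g_i(x)\le 0,\ i=1,\dots,m\}$ and $f^*=f(x^* )$. Suppose that $x^*\in X_k$ for $k=0,1,2,\dots$, where $X_k$ are the sets used in Algorithm APMM (see context). Define $\Gamma_1=1$, $\Gamma_k=\prod_{i=2}^k(1-\alpha_i)^{-1}$ for $k\ge2$, and $c_K=[\alpha_1^{1+\rho}\Gamma_1,\dots,\alpha_K^{1+\rho}\Gamma_K]\in\mathbb R^K$. Then after $K\ge 1$ iterations of Algorithm APMM, $$v(y^K,f^* )\le \Gamma_K^{-1}(1-\alpha_1)\,v(y^0,f^* )+\frac{\Gamma_K^{-1}\hat M}{1+\rho}\,\|c_K\|_{\frac{2}{1-\rho}}\,\|x^*-x^0\|^{\rho+1},$$ where $\hat M=\max_{0\le i\le m}\ \sup\{M_i(\bar x,\hat x):\ \|x^*-\bar x\|\le\|x^*-x^0\|,\ \|x^*-\hat x\|\le\|x^*-x^0\|\}$. In particular, setting $\alpha_k=\frac{2}{k+1}$ for all $k\ge 1$ gives $$\max\{f(y^K)-f^*,\ \|[g(y^K)]_+\|_\infty\}\le\frac{\hat M}{1+\rho}\,\|x^*-x^0\|^{\rho+1}\,\frac{2^{\rho+1}3^{(1-\rho)/2}}{K^{(1+3\rho)/2}}.$$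
   Context: Setting. $\mathcal X\subseteq\mathbb R^d$ is nonempty closed convex; $f,g_1,\dots,g_m:\mathbb R^d\to\mathbb R$ are convex; $g(x)=(g_1(x),\dots,g_m(x))$. $f'(x)$, $g_i'(x)$ denote (chosen) subgradients (the gradient where differentiable). $\|\cdot\|$ is the Euclidean norm, $\|\cdot\|_p$ the $\ell_p$ norm, with $\frac{2}{1-\rho}=\infty$ when $\rho=1$; $[\cdot]_+$ is the componentwise positive part. Smoothness: there are $\rho\in[0,1]$ and functions $M_i:\mathbb R^d\times\mathbb R^d\to(0,\infty)$, $0\le i\le m$, such that for all $x,y\in\mathbb R^d$: $f(y)-f(x)-\langle f'(x),y-x\rangle\le\frac{M_0(y,x)}{1+\rho}\|y-x\|^{1+\rho}$ and $g_i(y)-g_i(x)-\langle g_i'(x),y-x\rangle\le\frac{M_i(y,x)}{1+\rho}\|y-x\|^{1+\rho}$ for $1\le i\le m$. Notation: $\ell_h(x,y)=h(y)+\langle h'(y),x-y\rangle$; $v(x,\eta)=\max\{f(x)-\eta,g_1(x),\dots,g_m(x)\}$; $v_\ell(x,\bar x,\eta)=\max\{\ell_f(x,\bar x)-\eta,\ell_{g_1}(x,\bar x),\dots,\ell_{g_m}(x,\bar x)\}$. Algorithm APMM (inputs $x^0\in\mathcal X$, $f^*$, $\varepsilon$; averaging weights $\alpha_k\in(0,1]$ with $\alpha_k<1$ for $k\ge 2$). Set $y^0=x^0$, $X_0=\mathcal X$, $\bar v_0=v(y^0,f^* )$. For $k=1,2,\dots$: set $z^k=(1-\alpha_k)y^{k-1}+\alpha_kx^{k-1}$;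 let $x^k$ be the minimizer of $\frac12\|x-x^{k-1}\|^2$ over $x\in X_{k-1}$ subject to $v_\ell(x,z^k,f^* )\le0$; set $\tilde y^k=(1-\alpha_k)y^{k-1}+\alpha_kx^k$; if $\bar v_{k-1}<v(\tilde y^k,f^* )$ set $\bar v_k=\bar v_{k-1}$, $y^k=y^{k-1}$, else set $\bar v_k=v(\tilde y^k,f^* )$, $y^k=\tilde y^k$; stop if $\bar v_k\le\varepsilon$; otherwise choose a closed convex set $X_k\subseteq\mathcal X$. "After $K$ iterations" means that iterations $k=1,\dots,K$ have been executed. *)

theory Defs
  imports "HOL-Analysis.Analysis"
begin

text \<open>
  The constraint functions are a family \<open>g i\<close> with \<open>i \<in> {1..m}\<close>, with chosen subgradients \<open>g' i\<close>;
  the family \<open>M i\<close> of smoothness moduli has \<open>i \<in> {0..m}\<close>, where \<open>M 0\<close> belongs to the objective.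
\<close>

definition subgradient_map :: "('a::real_inner \<Rightarrow> real) \<Rightarrow> ('a \<Rightarrow> 'a) \<Rightarrow> bool" where
  "subgradient_map h h' \<longleftrightarrow> (\<forall>x y. h y \<ge> h x + h' x \<bullet> (y - x))"

definition upper_smooth ::
    "real \<Rightarrow> ('a::real_inner \<Rightarrow> 'a \<Rightarrow> real) \<Rightarrow> ('a \<Rightarrow> real) \<Rightarrow> ('a \<Rightarrow> 'a) \<Rightarrow> bool" where
  "upper_smooth \<rho> L h h' \<longleftrightarrow>
     (\<forall>x y. h y - h x - h' x \<bullet> (y - x) \<le> L y x / (1 + \<rho>) * norm (y - x) powr (1 + \<rho>))"

definition feasible :: "'a set \<Rightarrow> nat \<Rightarrow> (nat \<Rightarrow> 'a \<Rightarrow> real) \<Rightarrow> 'a \<Rightarrow> bool" where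
  "feasible C m g x \<longleftrightarrow> x \<in> C \<and> (\<forall>i\<in>{1..m}. g i x \<le> 0)"

text \<open>The linearization of \<open>h\<close> at \<open>y\<close>, evaluated at \<open>x\<close>.\<close>

definition lin :: "('a::real_inner \<Rightarrow> real) \<Rightarrow> ('a \<Rightarrow> 'a) \<Rightarrow> 'a \<Rightarrow> 'a \<Rightarrow> real" where
  "lin h h' x y = h y + h' y \<bullet> (x - y)"

definition viol :: "nat \<Rightarrow> ('a \<Rightarrow> real) \<Rightarrow> (nat \<Rightarrow> 'a \<Rightarrow> real) \<Rightarrow> 'a \<Rightarrow> real \<Rightarrow> real" where
  "viol m f g x \<eta> = Max (insert (f x - \<eta>) ((\<lambda>i. g i x) ` {1..m}))"

definition viol_lin ::
    "nat \<Rightarrow> ('a::real_inner \<Rightarrow> real) \<Rightarrow> ('a \<Rightarrow> 'a) \<Rightarrow> (nat \<Rightarrow> 'a \<Rightarrow> real) \<Rightarrow> (nat \<Rightarrow> 'a \<Rightarrow> 'a)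
      \<Rightarrow> 'a \<Rightarrow> 'a \<Rightarrow> real \<Rightarrow> real" where
  "viol_lin m f f' g g' x xb \<eta> =
     Max (insert (lin f f' x xb - \<eta>) ((\<lambda>i. lin (g i) (g' i) x xb) ` {1..m}))"

text \<open>
  The \<open>p\<close>-norm of the vector \<open>(u 1, \<dots>, u n)\<close>. The element \<open>0\<close> inserted for \<open>p = \<infinity>\<close> only
  matters when \<open>n = 0\<close>.
\<close>

definition lp_norm :: "ereal \<Rightarrow> nat \<Rightarrow> (nat \<Rightarrow> real) \<Rightarrow> real" where
  "lp_norm p n u =
     (if p = \<infinity> then Max (insert 0 ((\<lambda>i. \<bar>u i\<bar>) ` {1..n}))
      else (\<Sum>i=1..n. \<bar>u i\<bar> powr real_of_ereal p) powr (1 / real_of_ereal p))"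

definition hoelder_exp :: "real \<Rightarrow> ereal" where
  "hoelder_exp \<rho> = (if \<rho> = 1 then \<infinity> else ereal (2 / (1 - \<rho>)))"

text \<open>For \<open>k = 1\<close> the product is empty, so the value is \<open>1\<close>.\<close>

definition Gam :: "(nat \<Rightarrow> real) \<Rightarrow> nat \<Rightarrow> real" where
  "Gam \<alpha> k = (\<Prod>i=2..k. inverse (1 - \<alpha> i))"

definition c_vec :: "real \<Rightarrow> (nat \<Rightarrow> real) \<Rightarrow> nat \<Rightarrow> real" where
  "c_vec \<rho> \<alpha> k = \<alpha> k powr (1 + \<rho>) * Gam \<alpha> k"

text \<open>
  The suprema may be infinite, hence the type \<^typ>\<open>ereal\<close>.
\<close>

definition M_hat ::
    "nat \<Rightarrow> (nat \<Rightarrow> 'a::real_normed_vector \<Rightarrow> 'a \<Rightarrow> real) \<Rightarrow> 'a \<Rightarrow> 'a \<Rightarrow> ereal" where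
  "M_hat m M xstar x0 =
     Max ((\<lambda>i. Sup {ereal (M i xb xh) | xb xh.
                     norm (xstar - xb) \<le> norm (xstar - x0) \<and>
                     norm (xstar - xh) \<le> norm (xstar - x0)}) ` {0..m})"

text \<open>
  \<open>apmm_run \<dots> K x y vb X\<close>: the sequences \<open>x\<close>, \<open>y\<close>, \<open>vb\<close> (for the values \<open>v\<close>-bar) and \<open>X\<close> record an
  execution of APMM in which iterations \<open>1, \<dots>, K\<close> are carried out. The starting point is \<open>x 0\<close>.
  Iterations \<open>1, \<dots>, K - 1\<close> must not have triggered the stopping test and must have chosen the next
  set; iteration \<open>K\<close> may be the terminating one. Only entries with index up to \<open>K\<close> (for \<open>X\<close>: below
  \<open>K\<close>) are constrained.
\<close>

definition apmm_run ::
    "'a::real_inner set \<Rightarrow> nat \<Rightarrow> ('a \<Rightarrow> real) \<Rightarrow> ('a \<Rightarrow> 'a) \<Rightarrow> (nat \<Rightarrow> 'a \<Rightarrow> real) \<Rightarrow> (nat \<Rightarrow> 'a \<Rightarrow> 'a)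
      \<Rightarrow> real \<Rightarrow> real \<Rightarrow> (nat \<Rightarrow> real) \<Rightarrow> nat
      \<Rightarrow> (nat \<Rightarrow> 'a) \<Rightarrow> (nat \<Rightarrow> 'a) \<Rightarrow> (nat \<Rightarrow> real) \<Rightarrow> (nat \<Rightarrow> 'a set) \<Rightarrow> bool" where
  "apmm_run C m f f' g g' fstar \<epsilon> \<alpha> K x y vb X \<longleftrightarrow>
     x 0 \<in> C \<and> y 0 = x 0 \<and> X 0 = C \<and> vb 0 = viol m f g (y 0) fstar \<and>
     (\<forall>k\<in>{1..K}.
        let z = (1 - \<alpha> k) *\<^sub>R y (k - 1) + \<alpha> k *\<^sub>R x (k - 1);
            yt = (1 - \<alpha> k) *\<^sub>R y (k - 1) + \<alpha> k *\<^sub>R x k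
        in is_arg_min (\<lambda>u. 1/2 * (norm (u - x (k - 1)))\<^sup>2)
             (\<lambda>u. u \<in> X (k - 1) \<and> viol_lin m f f' g g' u z fstar \<le> 0) (x k) \<and>
           (if vb (k - 1) < viol m f g yt fstar
            then vb k = vb (k - 1) \<and> y k = y (k - 1)
            else vb k = viol m f g yt fstar \<and> y k = yt)) \<and>
     (\<forall>k\<in>{1..<K}. \<not> vb k \<le> \<epsilon> \<and> closed (X k) \<and> convex (X k) \<and> X k \<subseteq> C)"

end

theory Submission
  imports Defs
begin

text \<open>
  Write \<open>\<Delta>\<^sub>k = \<parallel>x\<^sup>k - x\<^sup>k\<^sup>-\<^sup>1\<parallel>\<close>. The optimal solution satisfies all the linearized constraints, so
  \<open>x\<^sup>k\<close> is the projection of \<open>x\<^sup>k\<^sup>-\<^sup>1\<close> onto a convex set containing \<open>x\<^sup>*\<close>, and Pythagoras gives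
  \<open>\<Sum> \<Delta>\<^sub>k\<^sup>2 \<le> \<parallel>x\<^sup>* - x\<^sup>0\<parallel>\<^sup>2\<close>; in particular the iterates stay in the ball over which \<open>M\<close> is
  maximized. Smoothness at \<open>z\<^sup>k\<close> yields
  \<open>v(y\<^sup>k) \<le> (1 - \<alpha>\<^sub>k) v(y\<^sup>k\<^sup>-\<^sup>1) + M / (1 + \<rho>) (\<alpha>\<^sub>k \<Delta>\<^sub>k)\<^sup>1\<^sup>+\<^sup>\<rho>\<close>. Multiplying by \<open>\<Gamma>\<^sub>k\<close> makes this
  telescope, and Hoelder's inequality with exponents \<open>2 / (1 - \<rho>)\<close> and \<open>2 / (1 + \<rho>)\<close> separates the
  weights from the \<open>\<Delta>\<^sub>k\<close>.
\<close>

section \<open>Hoelder's inequality and \<open>lp_norm\<close>\<close>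

lemma Max_insert_abs_ge:
  fixes u :: "nat \<Rightarrow> real"
  assumes "i \<in> {1..n}"
  shows "\<bar>u i\<bar> \<le> Max (insert 0 ((\<lambda>i. \<bar>u i\<bar>) ` {1..n}))"
  using assms by (intro Max_ge) auto

text \<open>Young's inequality is summed termwise after both vectors are scaled to unit norm. The
  scaling breaks down when one norm vanishes, but then every product is zero.\<close>

lemma Hoelder_inequality_sum:
  fixes p q :: real
  assumes p: "p > 1" and q: "q > 1" and pq: "1 / p + 1 / q = 1" and fin: "finite I"
    and a: "\<And>i. i \<in> I \<Longrightarrow> a i \<ge> 0" and b: "\<And>i. i \<in> I \<Longrightarrow> b i \<ge> 0"
  shows "(\<Sum>i\<in>I. a i * b i)
    \<le> (\<Sum>i\<in>I. a i powr p) powr (1 / p) * (\<Sum>i\<in>I. b i powr q) powr (1 / q)"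
proof -
  define A where "A = (\<Sum>i\<in>I. a i powr p)"
  define B where "B = (\<Sum>i\<in>I. b i powr q)"
  have AB: "A \<ge> 0" "B \<ge> 0"
    unfolding A_def B_def by (auto intro: sum_nonneg)
  show ?thesis
  proof (cases "A = 0 \<or> B = 0")
    case True
    then have "\<forall>i\<in>I. a i * b i = 0"
      unfolding A_def B_def using fin by (auto simp: sum_nonneg_eq_0_iff)
    then have "(\<Sum>i\<in>I. a i * b i) = 0"
      by (intro sum.neutral) auto
    then show ?thesis by simp
  next
    case False
    then have pos: "A > 0" "B > 0" using AB by auto
    define r where "r = A powr (1 / p)"
    define s where "s = B powr (1 / q)"
    have rs: "r > 0" "s > 0" "r powr p = A" "s powr q = B"
      using pos p q by (auto simp: r_def s_def powr_powr)
    have "(\<Sum>i\<in>I. (a i / r) * (b i / s)) \<le> (\<Sum>i\<in>I. (a i / r) powr p / p + (b i / s) powr q / q)"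
      using a b rs p q pq by (intro sum_mono Youngs_inequality) auto
    also have "\<dots> = (\<Sum>i\<in>I. a i powr p / (A * p) + b i powr q / (B * q))"
      using a b rs by (intro sum.cong) (auto simp: powr_divide)
    also have "\<dots> = A / (A * p) + B / (B * q)"
      by (simp add: sum.distrib A_def B_def flip: sum_divide_distrib)
    also have "\<dots> = 1"
      using pos pq by simp
    finally have "(\<Sum>i\<in>I. a i * b i) / (r * s) \<le> 1"
      by (simp add: sum_divide_distrib)
    then show ?thesis
      using rs by (simp add: divide_le_eq r_def s_def A_def B_def)
  qed
qed

text \<open>The exponent \<open>q = 2 / (1 + \<rho>)\<close> turns
  \<open>d k powr (1 + \<rho>)\<close> into \<open>(d k)\<^sup>2\<close>, whose sum is controlled.
  At \<open>\<rho> = 1\<close> the conjugate exponents are \<infinity> and 1, and the largest weight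
  is pulled out directly.\<close>

lemma sum_mult_powr_le_lp_norm:
  assumes \<rho>: "0 \<le> \<rho>" "\<rho> \<le> 1" and d: "\<And>k. k \<in> {1..n} \<Longrightarrow> d k \<ge> 0"
    and u: "\<And>k. k \<in> {1..n} \<Longrightarrow> u k \<ge> 0" and D: "D \<ge> 0" "(\<Sum>k=1..n. (d k)\<^sup>2) \<le> D\<^sup>2"
  shows "(\<Sum>k=1..n. u k * d k powr (1 + \<rho>)) \<le> lp_norm (hoelder_exp \<rho>) n u * D powr (1 + \<rho>)"
proof (cases "\<rho> = 1")
  case True
  define N where "N = Max (insert 0 ((\<lambda>i. \<bar>u i\<bar>) ` {1..n}))"
  have N: "u k \<le> N" if "k \<in> {1..n}" for k
    using Max_insert_abs_ge[OF that, of u] unfolding N_def by linarith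
  have "(\<Sum>k=1..n. u k * d k powr (1 + \<rho>)) \<le> (\<Sum>k=1..n. N * (d k)\<^sup>2)"
    using d N True by (intro sum_mono) (auto intro!: mult_right_mono)
  also have "\<dots> \<le> N * D\<^sup>2"
    unfolding sum_distrib_left[symmetric] using D by (intro mult_left_mono) (auto simp: N_def)
  finally show ?thesis
    using True D by (simp add: lp_norm_def hoelder_exp_def N_def)
next
  case False
  then have lt: "\<rho> < 1" using \<rho> by simp
  define p where "p = 2 / (1 - \<rho>)"
  define q where "q = 2 / (1 + \<rho>)"
  have pq: "p > 1" "q > 1" "1 / p + 1 / q = 1"
    using \<rho> lt by (auto simp: p_def q_def field_simps)
  have dq: "(d k powr (1 + \<rho>)) powr q = (d k)\<^sup>2" if "k \<in> {1..n}" for k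
  proof -
    have "(1 + \<rho>) * q = 2"
      using \<rho> by (simp add: q_def field_simps)
    then have "(d k powr (1 + \<rho>)) powr q = d k powr 2"
      by (simp only: powr_powr)
    then show ?thesis
      using d[OF that] by simp
  qed
  have "(\<Sum>k=1..n. u k * d k powr (1 + \<rho>))
      \<le> (\<Sum>k=1..n. u k powr p) powr (1 / p) * (\<Sum>k=1..n. (d k powr (1 + \<rho>)) powr q) powr (1 / q)"
    using pq u by (intro Hoelder_inequality_sum) auto
  also have "(\<Sum>k=1..n. u k powr p) powr (1 / p) = lp_norm (hoelder_exp \<rho>) n u"
    using False u by (simp add: lp_norm_def hoelder_exp_def p_def)
  also have "(\<Sum>k=1..n. (d k powr (1 + \<rho>)) powr q) = (\<Sum>k=1..n. (d k)\<^sup>2)"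
    using dq by (intro sum.cong) auto
  also have "\<dots> powr (1 / q) \<le> (D\<^sup>2) powr (1 / q)"
    using pq D by (intro powr_mono2) (auto intro: sum_nonneg)
  also have "(D\<^sup>2) powr (1 / q) = D powr (1 + \<rho>)"
  proof -
    have "2 * (1 / q) = 1 + \<rho>"
      by (simp add: q_def field_simps)
    then have "(D powr 2) powr (1 / q) = D powr (1 + \<rho>)"
      by (simp only: powr_powr)
    then show ?thesis
      using D by simp
  qed
  finally show ?thesis
    by (simp add: mult_left_mono lp_norm_def)
qed

lemma lp_norm_mono:
  assumes p: "p > 0" and u: "\<And>i. i \<in> {1..n} \<Longrightarrow> \<bar>u i\<bar> \<le> \<bar>v i\<bar>"
  shows "lp_norm p n u \<le> lp_norm p n v"
proof (cases "p = \<infinity>")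
  case True
  have "\<bar>u i\<bar> \<le> Max (insert 0 ((\<lambda>i. \<bar>v i\<bar>) ` {1..n}))" if "i \<in> {1..n}" for i
    using u[OF that] Max_insert_abs_ge[OF that] by (rule order_trans)
  then show ?thesis
    using True by (auto simp: lp_norm_def)
next
  case False
  then obtain r where r: "p = ereal r" "r > 0"
    using p by (cases p) auto
  show ?thesis
    using r u by (auto simp: lp_norm_def intro!: powr_mono2 sum_mono sum_nonneg)
qed

text \<open>Serves the case of an infinite \<open>M_hat\<close>, where a vanishing norm would turn
  the bound into 0.\<close>

lemma lp_norm_pos:
  assumes n: "n \<ge> 1" and u: "\<And>i. i \<in> {1..n} \<Longrightarrow> u i > 0"
  shows "lp_norm p n u > 0"
proof (cases "p = \<infinity>")
  case True
  then show ?thesis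
    using Max_insert_abs_ge[of 1 n u] n u[of 1] by (simp add: lp_norm_def)
next
  case False
  have "(\<Sum>i=1..n. \<bar>u i\<bar> powr real_of_ereal p) > 0"
    using n u by (intro sum_pos) fastforce+
  then show ?thesis
    using False by (simp add: lp_norm_def)
qed

section \<open>Building blocks of a single iteration\<close>

lemma viol_le_iff:
  "viol m f g u \<eta> \<le> t \<longleftrightarrow> f u - \<eta> \<le> t \<and> (\<forall>i\<in>{1..m}. g i u \<le> t)"
  by (auto simp: viol_def)

lemma viol_lin_le_iff:
  "viol_lin m f f' g g' u z \<eta> \<le> t
    \<longleftrightarrow> lin f f' u z - \<eta> \<le> t \<and> (\<forall>i\<in>{1..m}. lin (g i) (g' i) u z \<le> t)"
  by (auto simp: viol_lin_def)

lemma projection_dist_sq: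
  fixes p q w :: "'a::real_inner"
  assumes S: "convex S" and q: "is_arg_min (\<lambda>u. 1/2 * (norm (u - p))\<^sup>2) (\<lambda>u. u \<in> S) q"
    and w: "w \<in> S"
  shows "(norm (w - q))\<^sup>2 + (norm (q - p))\<^sup>2 \<le> (norm (w - p))\<^sup>2"
proof -
  have qS: "q \<in> S" and min: "norm (q - p) \<le> norm (u - p)" if "u \<in> S" for u
    using q that power_strict_mono[of "norm (u - p)" "norm (q - p)" 2]
    by (auto simp: is_arg_min_linorder intro: power2_le_imp_le)
  have "(p - q) \<bullet> (w - q) \<le> 0"
  proof (rule ccontr)
    assume "\<not> (p - q) \<bullet> (w - q) \<le> 0"
    \<comment> \<open>With an acute angle, a short move from \<open>q\<close> towards
      \<open>w\<close> would come closer to \<open>p\<close>; convexity keeps the moved point in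
      \<open>S\<close>, against minimality.\<close>
    then obtain t where t: "t > 0" "t \<le> 1" "dist (q + t *\<^sub>R (w - q)) p < dist q p"
      using closer_point_lemma[of p q w] by auto
    have "q + t *\<^sub>R (w - q) \<in> S"
      using convexD_alt[OF S qS[OF w] w, of t] t by (simp add: algebra_simps)
    from min[OF this] t(3) show False
      by (simp add: dist_norm)
  qed
  moreover have "(norm (w - p))\<^sup>2 = (norm (w - q))\<^sup>2 + (norm (q - p))\<^sup>2 - 2 * ((p - q) \<bullet> (w - q))"
    by (simp add: power2_norm_eq_inner algebra_simps inner_commute)
  ultimately show ?thesis by simp
qed

text \<open>The averages \<open>yt\<close> and \<open>z\<close> differ by
  \<open>a *\<^sub>R (x' - x)\<close>, so the smoothness error carries the factor
  \<open>a powr (1 + \<rho>)\<close>. The linearization at \<open>z\<close> is affine and splits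
  along the average; at \<open>y\<close> it lies below \<open>h\<close>.\<close>

lemma smooth_extrapolation:
  assumes sub: "subgradient_map h h'" and smooth: "upper_smooth \<rho> L h h'"
    and \<rho>: "0 \<le> \<rho>" and a: "0 \<le> a" "a \<le> 1"
    and z: "z = (1 - a) *\<^sub>R y + a *\<^sub>R x" and yt: "yt = (1 - a) *\<^sub>R y + a *\<^sub>R x'"
    and B: "L yt z \<le> B"
  shows "h yt \<le> (1 - a) * h y + a * lin h h' x' z
    + B / (1 + \<rho>) * (a powr (1 + \<rho>) * norm (x' - x) powr (1 + \<rho>))"
proof -
  have diff: "yt - z = a *\<^sub>R (x' - x)"
    by (simp add: yt z algebra_simps)
  have "h yt \<le> lin h h' yt z + L yt z / (1 + \<rho>) * norm (yt - z) powr (1 + \<rho>)"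
    using smooth by (simp add: upper_smooth_def lin_def algebra_simps)
  also have "\<dots> \<le> lin h h' yt z + B / (1 + \<rho>) * norm (yt - z) powr (1 + \<rho>)"
    using B \<rho> by (intro add_left_mono mult_right_mono divide_right_mono) auto
  also have "norm (yt - z) powr (1 + \<rho>) = a powr (1 + \<rho>) * norm (x' - x) powr (1 + \<rho>)"
    using a by (simp add: diff powr_mult)
  also have "lin h h' yt z = (1 - a) * lin h h' y z + a * lin h h' x' z"
    by (simp add: lin_def yt algebra_simps)
  also have "\<dots> \<le> (1 - a) * h y + a * lin h h' x' z"
    using sub a by (intro add_right_mono mult_left_mono) (auto simp: subgradient_map_def lin_def)
  finally show ?thesis by simp
qed

section \<open>The weights \<open>Gam\<close>\<close>

lemma Gam_1 [simp]: "Gam \<alpha> (Suc 0) = 1"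
  by (simp add: Gam_def)

text \<open>The product has no factor of index 1, so the recursion starts at \<open>n = 1\<close>
  and \<open>\<alpha> 1 = 1\<close> does no harm.\<close>

lemma Gam_Suc: "n \<ge> 1 \<Longrightarrow> Gam \<alpha> (Suc n) = Gam \<alpha> n * inverse (1 - \<alpha> (Suc n))"
  by (simp add: Gam_def)

lemma Gam_pos:
  assumes "\<And>k. k \<ge> 2 \<Longrightarrow> \<alpha> k < (1::real)"
  shows "Gam \<alpha> k > 0"
  unfolding Gam_def using assms by (intro prod_pos) auto

text \<open>The factors are \<open>(i + 1) / (i - 1)\<close>, and their product telescopes.\<close>

lemma Gam_two_div:
  assumes "\<And>k. k \<ge> 1 \<Longrightarrow> \<alpha> k = 2 / (real k + 1)" "n \<ge> 1"
  shows "Gam \<alpha> n = real n * (real n + 1) / 2"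
  using assms(2)
proof (induction n rule: dec_induct)
  case (step n)
  then show ?case
    by (simp add: Gam_Suc assms(1) field_simps)
qed simp

section \<open>A run of the algorithm whose sets \<open>X k\<close> retain
  \<open>xstar\<close>\<close>

locale apmm =
  fixes C :: "'a::real_inner set" and m :: nat
    and f :: "'a \<Rightarrow> real" and f' :: "'a \<Rightarrow> 'a"
    and g :: "nat \<Rightarrow> 'a \<Rightarrow> real" and g' :: "nat \<Rightarrow> 'a \<Rightarrow> 'a"
    and M :: "nat \<Rightarrow> 'a \<Rightarrow> 'a \<Rightarrow> real"
    and \<rho> fstar \<epsilon> :: real and \<alpha> vb :: "nat \<Rightarrow> real" and K :: nat
    and xstar :: 'a and x y :: "nat \<Rightarrow> 'a" and X :: "nat \<Rightarrow> 'a set"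
  assumes convex_C: "convex C"
    and sub_f: "subgradient_map f f'"
    and sub_g: "\<And>i. i \<in> {1..m} \<Longrightarrow> subgradient_map (g i) (g' i)"
    and \<rho>: "0 \<le> \<rho>" "\<rho> \<le> 1"
    and smooth_f: "upper_smooth \<rho> (M 0) f f'"
    and smooth_g: "\<And>i. i \<in> {1..m} \<Longrightarrow> upper_smooth \<rho> (M i) (g i) (g' i)"
    and feasible_xstar: "feasible C m g xstar" and fstar: "fstar = f xstar"
    and \<alpha>: "\<And>k. k \<ge> 1 \<Longrightarrow> 0 < \<alpha> k \<and> \<alpha> k \<le> 1" and \<alpha>_less_1: "\<And>k. k \<ge> 2 \<Longrightarrow> \<alpha> k < 1"
    and K: "K \<ge> 1"
    and run: "apmm_run C m f f' g g' fstar \<epsilon> \<alpha> K x y vb X"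
    and xstar_in_X: "\<And>k. k < K \<Longrightarrow> xstar \<in> X k"
begin

abbreviation v :: "'a \<Rightarrow> real" where
  "v u \<equiv> viol m f g u fstar"

text \<open>\<open>z\<close>, \<open>yt\<close> and \<open>S\<close> name what iteration
  \<open>k \<ge> 1\<close> works with: the point of linearization, the candidate for
  \<open>y k\<close>, and the set onto which \<open>x (k - 1)\<close> is projected.\<close>

definition z :: "nat \<Rightarrow> 'a" where
  "z k = (1 - \<alpha> k) *\<^sub>R y (k - 1) + \<alpha> k *\<^sub>R x (k - 1)"

definition yt :: "nat \<Rightarrow> 'a" where
  "yt k = (1 - \<alpha> k) *\<^sub>R y (k - 1) + \<alpha> k *\<^sub>R x k"

definition S :: "nat \<Rightarrow> 'a set" where
  "S k = {u \<in> X (k - 1). viol_lin m f f' g g' u (z k) fstar \<le> 0}"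

lemma y_0: "y 0 = x 0" and vb_0: "vb 0 = v (y 0)"
  using run by (auto simp: apmm_run_def)

lemma iteration:
  assumes "k \<in> {1..K}"
  shows "is_arg_min (\<lambda>u. 1/2 * (norm (u - x (k - 1)))\<^sup>2) (\<lambda>u. u \<in> S k) (x k)"
    and "if vb (k - 1) < v (yt k) then vb k = vb (k - 1) \<and> y k = y (k - 1)
         else vb k = v (yt k) \<and> y k = yt k"
  using run assms by (auto simp: apmm_run_def Let_def S_def z_def yt_def simp del: One_nat_def)

lemma convex_X: "k < K \<Longrightarrow> convex (X k)"
  using run convex_C by (cases "k = 0") (auto simp: apmm_run_def)

text \<open>\<open>viol_lin\<close> is a maximum of affine functions of \<open>u\<close>, so its
  sublevel set is an intersection of half-spaces.\<close>

lemma convex_S: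
  assumes "k \<in> {1..K}"
  shows "convex (S k)"
proof -
  have half: "convex {u. lin h h' u (z k) \<le> c}" for h :: "'a \<Rightarrow> real" and h' c
    using convex_halfspace_le[of "h' (z k)" "c - h (z k) + h' (z k) \<bullet> z k"]
    by (simp add: lin_def algebra_simps)
  have "S k = X (k - 1) \<inter> ({u. lin f f' u (z k) \<le> fstar}
      \<inter> (\<Inter>i\<in>{1..m}. {u. lin (g i) (g' i) u (z k) \<le> 0}))"
    by (auto simp: S_def viol_lin_le_iff)
  also have "convex \<dots>"
    using assms by (intro convex_Int convex_INT half convex_X) auto
  finally show ?thesis .
qed

lemma xstar_in_S:
  assumes "k \<in> {1..K}"
  shows "xstar \<in> S k"
proof -
  have "lin h h' xstar (z k) \<le> h xstar" if "subgradient_map h h'" for h h'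
    using that by (simp add: lin_def subgradient_map_def)
  from this[OF sub_f] this[OF sub_g]
  have "lin f f' xstar (z k) \<le> fstar" "\<forall>i\<in>{1..m}. lin (g i) (g' i) xstar (z k) \<le> 0"
    using feasible_xstar by (force simp: fstar feasible_def)+
  moreover have "xstar \<in> X (k - 1)"
    using assms by (intro xstar_in_X) auto
  ultimately show ?thesis
    by (simp add: S_def viol_lin_le_iff)
qed

section \<open>Distances to \<open>xstar\<close>\<close>

lemma Fejer:
  assumes "k \<in> {1..K}"
  shows "(norm (xstar - x k))\<^sup>2 + (norm (x k - x (k - 1)))\<^sup>2 \<le> (norm (xstar - x (k - 1)))\<^sup>2"
  using projection_dist_sq[OF convex_S iteration(1) xstar_in_S] assms by blast

text \<open>Telescoped form of \<open>Fejer\<close>. The first summand keeps the iterates in the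
  initial ball; the second is the input to Hoelder's inequality.\<close>

lemma sum_steps_sq:
  assumes "k \<le> K"
  shows "(norm (xstar - x k))\<^sup>2 + (\<Sum>i=1..k. (norm (x i - x (i - 1)))\<^sup>2) \<le> (norm (xstar - x 0))\<^sup>2"
  using assms
proof (induction k)
  case (Suc k)
  then show ?case
    using Fejer[of "Suc k"] by simp
qed simp

text \<open>The ball over which the suprema in \<open>M_hat\<close> are taken.\<close>

abbreviation init_ball :: "'a set" where
  "init_ball \<equiv> cball xstar (norm (xstar - x 0))"

lemma x_in_ball:
  assumes "k \<le> K"
  shows "x k \<in> init_ball"
proof -
  have "0 \<le> (\<Sum>i=1..k. (norm (x i - x (i - 1)))\<^sup>2)"
    by (intro sum_nonneg) auto
  with sum_steps_sq[OF assms] have "(norm (xstar - x k))\<^sup>2 \<le> (norm (xstar - x 0))\<^sup>2"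
    by linarith
  then show ?thesis
    by (auto simp: dist_norm intro: power2_le_imp_le)
qed

text \<open>Balls are convex and both points are averages. The premise on \<open>y (k - 1)\<close>
  is left to the induction in \<open>y_in_ball\<close>, whose step relies on this lemma.\<close>

lemma averaging_in_ball:
  assumes "k \<in> {1..K}" "y (k - 1) \<in> init_ball"
  shows "z k \<in> init_ball" "yt k \<in> init_ball"
proof -
  have "0 \<le> \<alpha> k" "\<alpha> k \<le> 1" "x k \<in> init_ball" "x (k - 1) \<in> init_ball"
    using assms(1) \<alpha>[of k] x_in_ball by auto
  with assms(2) show "z k \<in> init_ball" "yt k \<in> init_ball"
    unfolding z_def yt_def by (simp_all only: convexD_alt[OF convex_cball])
qed

lemma y_in_ball: "k \<le> K \<Longrightarrow> y k \<in> init_ball"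
proof (induction k)
  case 0
  then show ?case by (simp add: y_0 dist_norm)
next
  case (Suc k)
  then show ?case
    using iteration(2)[of "Suc k"] averaging_in_ball[of "Suc k"] by (auto split: if_splits)
qed

section \<open>Decrease of the violation\<close>

lemma vb_eq: "k \<le> K \<Longrightarrow> vb k = v (y k)"
proof (induction k)
  case 0
  then show ?case by (simp add: vb_0)
next
  case (Suc k)
  then show ?case
    using iteration(2)[of "Suc k"] by (auto split: if_splits)
qed

text \<open>\<open>smooth_extrapolation\<close> applies to each component of \<open>v\<close>. As
  \<open>x k\<close> satisfies the linearized constraints, the linear terms add at most
  \<open>\<alpha> k * fstar\<close> for the objective and nothing positive for the
  constraints.\<close>

lemma v_step:
  assumes k: "k \<in> {1..K}"
    and B: "\<And>i u w. i \<in> {0..m} \<Longrightarrow> u \<in> init_ball \<Longrightarrow> w \<in> init_ball \<Longrightarrow> M i u w \<le> B"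
  shows "v (y k) \<le> (1 - \<alpha> k) * v (y (k - 1))
    + B / (1 + \<rho>) * (\<alpha> k powr (1 + \<rho>) * norm (x k - x (k - 1)) powr (1 + \<rho>))"
    (is "_ \<le> _ + ?E")
proof -
  have \<alpha>k: "0 \<le> \<alpha> k" "\<alpha> k \<le> 1"
    using k \<alpha>[of k] by auto
  have "y (k - 1) \<in> init_ball"
    using k y_in_ball by auto
  then have M: "M i (yt k) (z k) \<le> B" if "i \<in> {0..m}" for i
    using averaging_in_ball k that by (intro B) auto
  have xk: "lin f f' (x k) (z k) \<le> fstar" "\<And>i. i \<in> {1..m} \<Longrightarrow> lin (g i) (g' i) (x k) (z k) \<le> 0"
    using iteration(1)[OF k] by (auto simp: is_arg_min_def S_def viol_lin_le_iff)
  have v: "f (y (k - 1)) - fstar \<le> v (y (k - 1))"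
      "\<And>i. i \<in> {1..m} \<Longrightarrow> g i (y (k - 1)) \<le> v (y (k - 1))"
    using viol_le_iff[of m f g "y (k - 1)" fstar "v (y (k - 1))"] by auto
  have "f (yt k) - fstar \<le> (1 - \<alpha> k) * v (y (k - 1)) + ?E"
  proof -
    have "f (yt k) \<le> (1 - \<alpha> k) * f (y (k - 1)) + \<alpha> k * lin f f' (x k) (z k) + ?E"
      using smooth_extrapolation[OF sub_f smooth_f \<rho>(1) \<alpha>k z_def yt_def M] by simp
    moreover have "\<alpha> k * lin f f' (x k) (z k) \<le> \<alpha> k * fstar"
      using xk \<alpha>k by (intro mult_left_mono)
    moreover have "(1 - \<alpha> k) * (f (y (k - 1)) - fstar) \<le> (1 - \<alpha> k) * v (y (k - 1))"
      using v \<alpha>k by (intro mult_left_mono) auto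
    ultimately show ?thesis
      by (simp add: algebra_simps)
  qed
  moreover have "g i (yt k) \<le> (1 - \<alpha> k) * v (y (k - 1)) + ?E" if i: "i \<in> {1..m}" for i
  proof -
    have "g i (yt k) \<le> (1 - \<alpha> k) * g i (y (k - 1)) + \<alpha> k * lin (g i) (g' i) (x k) (z k) + ?E"
      using smooth_extrapolation[OF sub_g smooth_g \<rho>(1) \<alpha>k z_def yt_def M] i by simp
    moreover have "\<alpha> k * lin (g i) (g' i) (x k) (z k) \<le> 0"
      using xk i \<alpha>k by (intro mult_nonneg_nonpos)
    moreover have "(1 - \<alpha> k) * g i (y (k - 1)) \<le> (1 - \<alpha> k) * v (y (k - 1))"
      using v i \<alpha>k by (intro mult_left_mono) auto
    ultimately show ?thesis by linarith
  qed
  ultimately have "v (yt k) \<le> (1 - \<alpha> k) * v (y (k - 1)) + ?E"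
    by (simp add: viol_le_iff)
  \<comment> \<open>A candidate worse than \<open>y (k - 1)\<close> is rejected, so the inequality
    holds in both branches of the update.\<close>
  moreover have "v (y k) \<le> v (yt k)"
    using iteration(2)[OF k] vb_eq[of k] vb_eq[of "k - 1"] k by (auto split: if_splits)
  ultimately show ?thesis by linarith
qed

text \<open>Multiplying \<open>v_step\<close> by the weight cancels the contraction factor. The
  first weight is 1, so the factor \<open>1 - \<alpha> 1\<close> survives on
  \<open>v (y 0)\<close>.\<close>

lemma Gam_v_le:
  assumes "n \<ge> 1" "n \<le> K"
    and B: "\<And>i u w. i \<in> {0..m} \<Longrightarrow> u \<in> init_ball \<Longrightarrow> w \<in> init_ball \<Longrightarrow> M i u w \<le> B"
  shows "Gam \<alpha> n * v (y n) \<le> (1 - \<alpha> 1) * v (y 0)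
    + B / (1 + \<rho>) * (\<Sum>k=1..n. c_vec \<rho> \<alpha> k * norm (x k - x (k - 1)) powr (1 + \<rho>))"
  using assms(1,2)
proof (induction n rule: dec_induct)
  case base
  then show ?case
    using v_step[OF _ B, of 1] by (simp add: c_vec_def)
next
  case (step n)
  define E where "E = \<alpha> (Suc n) powr (1 + \<rho>) * norm (x (Suc n) - x n) powr (1 + \<rho>)"
  have G: "Gam \<alpha> (Suc n) > 0"
    using \<alpha>_less_1 by (rule Gam_pos)
  \<comment> \<open>Here \<open>Suc n \<ge> 2\<close>, so the strict bound on the averaging weights
    applies.\<close>
  have "1 - \<alpha> (Suc n) \<noteq> 0"
    using \<alpha>_less_1[of "Suc n"] step by auto
  then have G_Suc: "Gam \<alpha> (Suc n) * (1 - \<alpha> (Suc n)) = Gam \<alpha> n"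
    using step by (simp add: Gam_Suc)
  have "Gam \<alpha> (Suc n) * v (y (Suc n))
      \<le> Gam \<alpha> (Suc n) * ((1 - \<alpha> (Suc n)) * v (y n) + B / (1 + \<rho>) * E)"
    using v_step[OF _ B, of "Suc n"] step G by (intro mult_left_mono) (auto simp: E_def)
  also have "\<dots> = Gam \<alpha> n * v (y n) + B / (1 + \<rho>) * (Gam \<alpha> (Suc n) * E)"
    by (simp add: distrib_left flip: G_Suc)
  finally show ?case
    using step.IH step.prems step.hyps by (simp add: c_vec_def E_def algebra_simps)
qed

text \<open>\<open>B\<close> is a real stand-in for \<open>M_hat\<close>; its sign allows the
  Hoelder bound to be multiplied by it.\<close>

lemma v_bound:
  assumes B: "\<And>i u w. i \<in> {0..m} \<Longrightarrow> u \<in> init_ball \<Longrightarrow> w \<in> init_ball \<Longrightarrow> M i u w \<le> B" and "B \<ge> 0"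
  shows "v (y K) \<le> inverse (Gam \<alpha> K) * (1 - \<alpha> 1) * v (y 0)
    + inverse (Gam \<alpha> K) * B / (1 + \<rho>) * lp_norm (hoelder_exp \<rho>) K (c_vec \<rho> \<alpha>)
      * norm (xstar - x 0) powr (\<rho> + 1)"
proof -
  have G: "Gam \<alpha> k > 0" for k
    using \<alpha>_less_1 by (rule Gam_pos)
  have "(\<Sum>k=1..K. c_vec \<rho> \<alpha> k * norm (x k - x (k - 1)) powr (1 + \<rho>))
      \<le> lp_norm (hoelder_exp \<rho>) K (c_vec \<rho> \<alpha>) * norm (xstar - x 0) powr (1 + \<rho>)"
    using sum_steps_sq[of K] G
    by (intro sum_mult_powr_le_lp_norm \<rho>) (auto simp: c_vec_def less_imp_le intro: order_trans[rotated])
  then have "Gam \<alpha> K * v (y K) \<le> (1 - \<alpha> 1) * v (y 0)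
      + B / (1 + \<rho>) * (lp_norm (hoelder_exp \<rho>) K (c_vec \<rho> \<alpha>) * norm (xstar - x 0) powr (1 + \<rho>))"
    using \<open>B \<ge> 0\<close> \<rho>
    by (intro order_trans[OF Gam_v_le[OF K _ B]] add_left_mono mult_left_mono) auto
  then have "v (y K) \<le> inverse (Gam \<alpha> K) * ((1 - \<alpha> 1) * v (y 0)
      + B / (1 + \<rho>) * (lp_norm (hoelder_exp \<rho>) K (c_vec \<rho> \<alpha>) * norm (xstar - x 0) powr (1 + \<rho>)))"
    using G[of K] by (simp only: inverse_eq_divide pos_le_divide_eq times_divide_eq_left
        mult_1_left mult.commute[of "v (y K)"])
  then show ?thesis
    by (simp add: distrib_left mult_ac add.commute[of 1 \<rho>])
qed

end

section \<open>The averaging weights \<open>\<alpha> k = 2 / (k + 1)\<close>\<close>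

lemma lp_norm_c_vec_two_div:
  assumes \<rho>: "0 \<le> \<rho>" "\<rho> \<le> 1" and \<alpha>: "\<And>k. k \<ge> 1 \<Longrightarrow> \<alpha> k = 2 / (real k + 1)" and "K \<ge> 1"
  shows "lp_norm (hoelder_exp \<rho>) K (c_vec \<rho> \<alpha>) \<le> 2 powr \<rho> * real K powr (3 * (1 - \<rho>) / 2)"
proof -
  \<comment> \<open>Each entry equals \<open>2 powr \<rho> * (k * (k + 1) powr - \<rho>)\<close>, at
    most \<open>2 powr \<rho> * k powr (1 - \<rho>)\<close>; the last index then gives one constant
    for all entries.\<close>
  have c: "\<bar>c_vec \<rho> \<alpha> k\<bar> \<le> 2 powr \<rho> * real K powr (1 - \<rho>)" if "k \<in> {1..K}" for k
  proof -
    have k: "k \<ge> 1" "k \<le> K" using that by auto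
    have "\<bar>c_vec \<rho> \<alpha> k\<bar> = (2 / (real k + 1)) powr (1 + \<rho>) * (real k * (real k + 1) / 2)"
      using k by (simp add: c_vec_def \<alpha> Gam_two_div abs_mult)
    also have "\<dots> = 2 powr \<rho> * (real k * (real k + 1) powr - \<rho>)"
      using k by (simp add: powr_divide powr_add powr_minus divide_simps)
    also have "\<dots> \<le> 2 powr \<rho> * (real k * real k powr - \<rho>)"
      using k \<rho> by (intro mult_left_mono powr_mono2') auto
    also have "\<dots> = 2 powr \<rho> * real k powr (1 - \<rho>)"
      using k by (simp add: powr_diff powr_minus field_simps)
    also have "\<dots> \<le> 2 powr \<rho> * real K powr (1 - \<rho>)"
      using k \<rho> by (intro mult_left_mono powr_mono2) auto
    finally show ?thesis .
  qed
  have "lp_norm (hoelder_exp \<rho>) K (c_vec \<rho> \<alpha>)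
      \<le> lp_norm (hoelder_exp \<rho>) K (\<lambda>_. 2 powr \<rho> * real K powr (1 - \<rho>))"
    using c \<rho> by (intro lp_norm_mono) (auto simp: hoelder_exp_def)
  \<comment> \<open>A constant vector of length \<open>K\<close> has norm
    \<open>K powr ((1 - \<rho>) / 2)\<close> times the constant.\<close>
  also have "\<dots> = 2 powr \<rho> * real K powr (3 * (1 - \<rho>) / 2)"
  proof (cases "\<rho> = 1")
    case True
    then show ?thesis
      using \<open>K \<ge> 1\<close> by (simp add: lp_norm_def hoelder_exp_def)
  next
    case False
    then have "(real K * (2 powr \<rho> * real K powr (1 - \<rho>)) powr (2 / (1 - \<rho>))) powr ((1 - \<rho>) / 2)
        = real K powr ((1 - \<rho>) / 2) * (2 powr \<rho> * real K powr (1 - \<rho>))"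
    proof -
      have "(1 - \<rho>) * (2 / (1 - \<rho>)) * ((1 - \<rho>) / 2) = 1 - \<rho>"
        "2 / (1 - \<rho>) * ((1 - \<rho>) / 2) = 1"
        using False by simp_all
      then show ?thesis
        by (simp only: powr_mult powr_powr mult.assoc mult_1_right)
    qed
    also have "\<dots> = 2 powr \<rho> * real K powr ((1 - \<rho>) / 2 + (1 - \<rho>))"
      by (simp add: powr_add)
    also have "(1 - \<rho>) / 2 + (1 - \<rho>) = 3 * (1 - \<rho>) / 2"
      by (simp add: field_simps)
    finally show ?thesis
      using False by (simp add: lp_norm_def hoelder_exp_def)
  qed
  finally show ?thesis .
qed

text \<open>\<open>Gam \<alpha> K\<close> is at least half of \<open>K\<^sup>2\<close>, which lowers
  the exponent \<open>3 * (1 - \<rho>) / 2\<close> by 2.\<close>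

lemma rate_two_div:
  assumes \<rho>: "0 \<le> \<rho>" "\<rho> \<le> 1" and \<alpha>: "\<And>k. k \<ge> 1 \<Longrightarrow> \<alpha> k = 2 / (real k + 1)" and "K \<ge> 1"
  shows "inverse (Gam \<alpha> K) * lp_norm (hoelder_exp \<rho>) K (c_vec \<rho> \<alpha>)
    \<le> 2 powr (\<rho> + 1) * 3 powr ((1 - \<rho>) / 2) / real K powr ((1 + 3 * \<rho>) / 2)"
proof -
  have K: "real K > 0" using \<open>K \<ge> 1\<close> by simp
  have "(real K)\<^sup>2 \<le> real K * (real K + 1)"
    by (simp add: power2_eq_square distrib_left)
  then have "inverse (Gam \<alpha> K) \<le> 2 / real K powr 2"
    using K \<open>K \<ge> 1\<close> by (simp add: Gam_two_div[OF \<alpha>] divide_left_mono)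
  then have "inverse (Gam \<alpha> K) * lp_norm (hoelder_exp \<rho>) K (c_vec \<rho> \<alpha>)
      \<le> 2 / real K powr 2 * (2 powr \<rho> * real K powr (3 * (1 - \<rho>) / 2))"
    using lp_norm_c_vec_two_div[OF \<rho> \<alpha> \<open>K \<ge> 1\<close>]
    by (intro mult_mono) (auto simp: lp_norm_def)
  also have "\<dots> = 2 powr (\<rho> + 1) * real K powr (3 * (1 - \<rho>) / 2 - 2)"
    using K by (simp add: powr_add powr_diff)
  also have "3 * (1 - \<rho>) / 2 - 2 = - ((1 + 3 * \<rho>) / 2)"
    by (simp add: field_simps)
  also have "2 powr (\<rho> + 1) * real K powr \<dots> = 2 powr (\<rho> + 1) * 1 / real K powr ((1 + 3 * \<rho>) / 2)"
    by (simp add: powr_minus field_simps)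
  \<comment> \<open>The factor \<open>3 powr ((1 - \<rho>) / 2)\<close> is at least 1 and only
    relaxes the bound reached so far.\<close>
  also have "\<dots> \<le> 2 powr (\<rho> + 1) * 3 powr ((1 - \<rho>) / 2) / real K powr ((1 + 3 * \<rho>) / 2)"
    using \<rho> by (intro divide_right_mono mult_left_mono) (auto intro: ge_one_powr_ge_zero)
  finally show ?thesis .
qed

section \<open>The constant \<open>M_hat\<close>\<close>

lemma M_hat_ge:
  assumes "i \<in> {0..m}" "norm (w - u) \<le> norm (w - x0)" "norm (w - u') \<le> norm (w - x0)"
  shows "ereal (M i u u') \<le> M_hat m M w x0"
proof -
  have "ereal (M i u u') \<le> Sup {ereal (M i xb xh) | xb xh.
      norm (w - xb) \<le> norm (w - x0) \<and> norm (w - xh) \<le> norm (w - x0)}"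
    using assms by (intro Sup_upper) blast
  also have "\<dots> \<le> M_hat m M w x0"
    unfolding M_hat_def using assms by (intro Max_ge) auto
  finally show ?thesis .
qed

text \<open>A ball of radius 0 is a single point, so each supremum is a single real. Hence an
  infinite \<open>M_hat\<close> forces \<open>xstar \<noteq> x 0\<close>.\<close>

lemma M_hat_degenerate: "M_hat m M x0 x0 \<noteq> \<infinity>"
proof -
  have "M_hat m M x0 x0 = Max ((\<lambda>i. ereal (M i x0 x0)) ` {0..m})"
    unfolding M_hat_def by (intro arg_cong[of _ _ Max] image_cong) auto
  also have "\<dots> \<in> (\<lambda>i. ereal (M i x0 x0)) ` {0..m}"
    by (intro Max_in) auto
  finally show ?thesis by auto
qed

theorem theorem2p1:
  fixes C :: "(real ^ 'd) set"
    and m K :: nat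
    and f :: "real ^ 'd \<Rightarrow> real" and f' :: "real ^ 'd \<Rightarrow> real ^ 'd"
    and g :: "nat \<Rightarrow> real ^ 'd \<Rightarrow> real" and g' :: "nat \<Rightarrow> real ^ 'd \<Rightarrow> real ^ 'd"
    and M :: "nat \<Rightarrow> real ^ 'd \<Rightarrow> real ^ 'd \<Rightarrow> real"
    and \<rho> fstar \<epsilon> :: real
    and \<alpha> vb :: "nat \<Rightarrow> real"
    and xstar :: "real ^ 'd"
    and x y :: "nat \<Rightarrow> real ^ 'd"
    and X :: "nat \<Rightarrow> (real ^ 'd) set"
  assumes "C \<noteq> {}" and "closed C" and "convex C"
    and "convex_on UNIV f" and "\<And>i. i \<in> {1..m} \<Longrightarrow> convex_on UNIV (g i)"
    and "subgradient_map f f'" and "\<And>i. i \<in> {1..m} \<Longrightarrow> subgradient_map (g i) (g' i)"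
    and "0 \<le> \<rho>" and "\<rho> \<le> 1"
    and "\<And>i u w. i \<in> {0..m} \<Longrightarrow> 0 < M i u w"
    and "upper_smooth \<rho> (M 0) f f'"
    and "\<And>i. i \<in> {1..m} \<Longrightarrow> upper_smooth \<rho> (M i) (g i) (g' i)"
    and "is_arg_min f (feasible C m g) xstar" and "fstar = f xstar"
    and "\<And>k. k \<ge> 1 \<Longrightarrow> 0 < \<alpha> k \<and> \<alpha> k \<le> 1" and "\<And>k. k \<ge> 2 \<Longrightarrow> \<alpha> k < 1"
    and "K \<ge> 1"
    and "apmm_run C m f f' g g' fstar \<epsilon> \<alpha> K x y vb X"
    and "\<And>k. k < K \<Longrightarrow> xstar \<in> X k"
  shows "ereal (viol m f g (y K) fstar)
           \<le> ereal (inverse (Gam \<alpha> K) * (1 - \<alpha> 1) * viol m f g (y 0) fstar)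
             + ereal (inverse (Gam \<alpha> K)) * M_hat m M xstar (x 0) / ereal (1 + \<rho>)
               * ereal (lp_norm (hoelder_exp \<rho>) K (c_vec \<rho> \<alpha>))
               * ereal (norm (xstar - x 0) powr (\<rho> + 1))
       \<and> ((\<forall>k\<ge>1. \<alpha> k = 2 / (real k + 1)) \<longrightarrow>
           ereal (max (f (y K) - fstar) (lp_norm \<infinity> m (\<lambda>i. max (g i (y K)) 0)))
             \<le> M_hat m M xstar (x 0) / ereal (1 + \<rho>)
               * ereal (norm (xstar - x 0) powr (\<rho> + 1))
               * ereal (2 powr (\<rho> + 1) * 3 powr ((1 - \<rho>) / 2)
                          / real K powr ((1 + 3 * \<rho>) / 2)))"
proof -
  interpret apmm C m f f' g g' M \<rho> fstar \<epsilon> \<alpha> vb K xstar x y X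
    using assms by unfold_locales (auto simp: is_arg_min_def)
  define D where "D = norm (xstar - x 0)"
  define N where "N = lp_norm (hoelder_exp \<rho>) K (c_vec \<rho> \<alpha>)"
  define R where
    "R = 2 powr (\<rho> + 1) * 3 powr ((1 - \<rho>) / 2) / real K powr ((1 + 3 * \<rho>) / 2)"
  have G: "Gam \<alpha> k > 0" for k
    using \<alpha>_less_1 by (rule Gam_pos)
  have N: "N > 0"
    unfolding N_def using K G \<alpha> by (intro lp_norm_pos) (force simp: c_vec_def)+
  have R: "R > 0"
    using K by (simp add: R_def)
  \<comment> \<open>Excludes the value -\<infinity> and makes \<open>B\<close> positive in the
    finite case.\<close>
  have M_pos: "0 < M_hat m M xstar (x 0)"
  proof -
    have "0 < ereal (M 0 xstar xstar)"
      using assms(10)[of 0] by simp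
    also have "\<dots> \<le> M_hat m M xstar (x 0)"
      by (rule M_hat_ge) auto
    finally show ?thesis .
  qed
  show ?thesis
  proof (cases "M_hat m M xstar (x 0) = \<infinity>")
    case True
    \<comment> \<open>In \<^typ>\<open>ereal\<close>, \<open>\<infinity> * 0 = 0\<close>, so an infinite bound requires all the other factors to be
      nonzero.\<close>
    then have "D > 0"
      using M_hat_degenerate[of m M "x 0"] by (auto simp: D_def)
    then show ?thesis
      using True N R G[of K] \<rho> unfolding D_def[symmetric] N_def[symmetric] R_def[symmetric]
      by simp
  next
    case False
    then obtain B where B: "M_hat m M xstar (x 0) = ereal B" "B > 0"
      using M_pos by (cases "M_hat m M xstar (x 0)") auto
    have "M i u w \<le> B" if "i \<in> {0..m}" "u \<in> init_ball" "w \<in> init_ball" for i u w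
      using M_hat_ge[of i m xstar u "x 0" w M] that B by (simp add: dist_norm)
    then have bound: "v (y K) \<le> inverse (Gam \<alpha> K) * (1 - \<alpha> 1) * v (y 0)
        + inverse (Gam \<alpha> K) * B / (1 + \<rho>) * N * D powr (\<rho> + 1)"
      unfolding N_def D_def using B by (intro v_bound) auto
    have "max (f (y K) - fstar) (lp_norm \<infinity> m (\<lambda>i. max (g i (y K)) 0))
        \<le> B / (1 + \<rho>) * D powr (\<rho> + 1) * R" (is "_ \<le> ?rhs")
      if \<alpha>2: "\<forall>k\<ge>1. \<alpha> k = 2 / (real k + 1)"
    proof -
      \<comment> \<open>\<open>\<alpha> 1 = 1\<close> removes the term with
        \<open>v (y 0)\<close>.\<close>
      have "v (y K) \<le> B / (1 + \<rho>) * D powr (\<rho> + 1) * (inverse (Gam \<alpha> K) * N)"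
        using bound \<alpha>2[rule_format, of 1] by (simp add: mult_ac)
      also have "\<dots> \<le> ?rhs"
        unfolding N_def R_def using \<alpha>2 B \<rho> K
        by (intro mult_left_mono rate_two_div) auto
      finally have "v (y K) \<le> ?rhs" .
      \<comment> \<open>\<open>v (y K)\<close> may be negative, whereas the norm of the positive
        parts is not.\<close>
      moreover have "?rhs \<ge> 0"
        using B \<rho> R by simp
      ultimately show ?thesis
        by (auto simp: viol_le_iff lp_norm_def)
    qed
    with bound show ?thesis
      using \<rho> unfolding D_def[symmetric] N_def[symmetric] R_def[symmetric] B(1) by simp
  qed
qed

end
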